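(* Let $\mathcal{H}$ be a real Hilbert space, let $m\ge1$ be an integer, and let $U_1,\ldots,U_m$ be closed affine subspaces of $\mathcal{H}$ with $\bigcap_{i=1}^mU_i\ne\varnothing$. Then the following hold: (i) Assume that for every $i\in\{1,\ldots,m\}$ the sum $\sum_{j=1}^i(\operatorname{par}U_j)^\perp$ is closed. Then $\mathrm{P}_{U_m}\cdots\mathrm{P}_{U_2}\mathrm{P}_{U_1}$ is a BAM; moreover, there exists $\gamma\in[0,1[$ such that $$(\forall x\in\mathcal{H})(\forall k\in\mathbb{N})\quad\big\|(\mathrm{P}_{U_m}\cdots\mathrm{P}_{U_2}\mathrm{P}_{U_1})^kx-\mathrm{P}_{\bigcap_{i=1}^mU_i}x\big\|\le\gamma^k\big\|x-\mathrm{P}_{\bigcap_{i=1}^mU_i}x\big\|.$$ (ii) Suppose that $\sum_{i=1}^m(\operatorname{par}U_i)^\perp$ is closed. Let $(\omega_i)_{1\le i\le m}$ be real numbers in $]0,1]$ such that $\sum_{i=1}^m\omega_i=1$. Then $\sum_{i=1}^m\omega_i\mathrm{P}_{U_i}$ is a BAM. Moreover, there exists $\gamma\in[0,1[$ such that $$(\forall x\in\mathcal{H})(\forall k\in\mathbb{N})\quad\Big\|\Big(\sum_{i=1}^m\omega_i\mathrm{P}_{U_i}\Big)^kx-\mathrm{P}_{\bigcap_{i=1}^mU_i}x\Big\|\le\gamma^k\big\|x-\mathrm{P}_{\bigcap_{i=1}^mU_i}x\big\|.$$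
   Context: For a nonempty closed convex set $C\subseteq\mathcal{H}$, $\mathrm{P}_C$ denotes the metric projection onto $C$. $\operatorname{Fix}G=\{x\in\mathcal{H}: Gx=x\}$. For an affine subspace $U$ (nonempty by convention), $\operatorname{par}U=U-u$ (any $u\in U$) is the linear subspace parallel to $U$. Products of operators denote composition. $\mathbb{N}=\{0,1,2,\ldots\}$. Definition (BAM). Let $G:\mathcal{H}\to\mathcal{H}$ and $\gamma\in[0,1[$. $G$ is a best approximation mapping with constant $\gamma$ ($\gamma$-BAM) if (1) $\operatorname{Fix}G$ is a nonempty closed convex subset of $\mathcal{H}$; (2) $\mathrm{P}_{\operatorname{Fix}G}G=\mathrm{P}_{\operatorname{Fix}G}$; (3) $\|Gx-\mathrm{P}_{\operatorname{Fix}G}x\|\le\gamma\|x-\mathrm{P}_{\operatorname{Fix}G}x\|$ for all $x\in\mathcal{H}$. $G$ is a BAM if it is a $\gamma$-BAM for some $\gamma\in[0,1[$. *)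

theory Defs
  imports "HOL-Analysis.Analysis"
begin

text \<open>
  The library's \<open>closest_point\<close> requires the class \<open>heine_borel\<close>, hence finite dimension.
  In a Hilbert space the nearest point exists and is unique whenever \<open>C\<close> is nonempty, closed
  and convex; for other \<open>C\<close> the value of \<open>metric_proj C\<close> may be unspecified.
\<close>

definition metric_proj :: "'a::real_inner set \<Rightarrow> 'a \<Rightarrow> 'a"
  where "metric_proj C x = (THE p. p \<in> C \<and> (\<forall>y\<in>C. dist x p \<le> dist x y))"

definition Fix :: "('a \<Rightarrow> 'a) \<Rightarrow> 'a set"
  where "Fix G = {x. G x = x}"

text \<open>The choice of the base point is immaterial for affine sets, see \<open>par_eq\<close> below.\<close>

definition par :: "'a::real_vector set \<Rightarrow> 'a set"
  where "par U = (\<lambda>x. x - (SOME u. u \<in> U)) ` U"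

lemma par_eq:
  assumes "affine U" and "u \<in> U"
  shows "par U = (\<lambda>x. x - u) ` U"
proof -
  have *: "(\<lambda>x. x - v) ` U \<subseteq> (\<lambda>x. x - w) ` U" if "v \<in> U" "w \<in> U" for v w
  proof
    fix y assume "y \<in> (\<lambda>x. x - v) ` U"
    then obtain x where x: "x \<in> U" "y = x - v" by blast
    have "1 *\<^sub>R (x - v) + w \<in> U"
      using mem_affine_3_minus[OF assms(1) that(2) x(1) that(1), of 1] by (simp add: algebra_simps)
    then have "x - v + w \<in> U" by simp
    moreover have "y = (x - v + w) - w" using x by simp
    ultimately show "y \<in> (\<lambda>x. x - w) ` U" by (rule rev_image_eqI)
  qed
  have s: "(SOME u. u \<in> U) \<in> U" using assms(2) by (rule someI)
  show ?thesis unfolding par_def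
    using *[OF s assms(2)] *[OF assms(2) s] by (rule subset_antisym)
qed

definition BAM_with :: "real \<Rightarrow> ('a::real_inner \<Rightarrow> 'a) \<Rightarrow> bool"
  where "BAM_with \<gamma> G \<longleftrightarrow>
    0 \<le> \<gamma> \<and> \<gamma> < 1 \<and>
    Fix G \<noteq> {} \<and> closed (Fix G) \<and> convex (Fix G) \<and>
    metric_proj (Fix G) \<circ> G = metric_proj (Fix G) \<and>
    (\<forall>x. norm (G x - metric_proj (Fix G) x) \<le> \<gamma> * norm (x - metric_proj (Fix G) x))"

definition BAM :: "('a::real_inner \<Rightarrow> 'a) \<Rightarrow> bool"
  where "BAM G \<longleftrightarrow> (\<exists>\<gamma>. BAM_with \<gamma> G)"

text \<open>
  \<open>cyclic_proj U m\<close> is the composition \<open>P (U m) \<circ> \<dots> \<circ> P (U 2) \<circ> P (U 1)\<close>: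
  \<open>fold\<close> applies the projection for the first list entry first.
\<close>

definition cyclic_proj :: "(nat \<Rightarrow> 'a::real_inner set) \<Rightarrow> nat \<Rightarrow> 'a \<Rightarrow> 'a"
  where "cyclic_proj U m = fold (\<lambda>i. metric_proj (U i)) [1..<Suc m]"

definition averaged_proj :: "(nat \<Rightarrow> real) \<Rightarrow> (nat \<Rightarrow> 'a::real_inner set) \<Rightarrow> nat \<Rightarrow> 'a \<Rightarrow> 'a"
  where "averaged_proj \<omega> U m x = (\<Sum>i=1..m. \<omega> i *\<^sub>R metric_proj (U i) x)"

end

theory Submission
  imports Defs
begin

text \<open>
  Write \<open>C\<close> for the intersection of the \<open>U\<^sub>i\<close> and \<open>P\<^sub>i\<close>, \<open>P\<close> for the projections onto \<open>U\<^sub>i\<close>, \<open>C\<close>.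
  Closedness of \<open>\<Sum>i. (par U\<^sub>i)\<^sup>\<bottom>\<close> gives linear regularity,
  \<open>\<parallel>x - P x\<parallel>\<^sup>2 \<le> \<kappa> * (\<Sum>i. \<parallel>x - P\<^sub>i x\<parallel>\<^sup>2)\<close>: every vector splits as \<open>v + (\<Sum>i. w\<^sub>i)\<close> with \<open>v\<close>
  parallel to \<open>C\<close> and \<open>w\<^sub>i \<bottom> par U\<^sub>i\<close>, and \<open>x - P x\<close> pairs with it to \<open>\<Sum>i. \<langle>x - P\<^sub>i x, w\<^sub>i\<rangle>\<close>, so the
  suitably scaled vectors \<open>x - P x\<close> are weakly bounded and hence bounded by the uniform
  boundedness principle. Both operators \<open>G\<close> satisfy
  \<open>\<Sum>i. \<parallel>x - P\<^sub>i x\<parallel>\<^sup>2 \<le> K * (\<parallel>x - P x\<parallel>\<^sup>2 - \<parallel>G x - P x\<parallel>\<^sup>2)\<close> by Pythagoras, which together with linear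
  regularity makes \<open>G\<close> contract the distance to \<open>C\<close>.
\<close>

subsection \<open>Projections onto closed affine subspaces\<close>

text \<open>A minimizing sequence is Cauchy by the parallelogram law, because midpoints stay in
  \<open>C\<close> and cannot undercut the infimum of the squared distances. Completeness supplies a
  limit, and closedness keeps it in \<open>C\<close>.\<close>

lemma closest_point_exists:
  fixes C :: "'a::{real_inner, banach} set"
  assumes "convex C" "closed C" "C \<noteq> {}"
  shows "\<exists>p\<in>C. \<forall>y\<in>C. dist x p \<le> dist x y"
proof -
  define D where "D = Inf ((\<lambda>y. (norm (x - y))\<^sup>2) ` C)"
  have bdd: "bdd_below ((\<lambda>y. (norm (x - y))\<^sup>2) ` C)"
    by (rule bdd_belowI[of _ 0]) auto
  have D_le: "D \<le> (norm (x - y))\<^sup>2" if "y \<in> C" for y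
    unfolding D_def using bdd that by (intro cInf_lower) auto
  have "\<exists>y\<in>C. (norm (x - y))\<^sup>2 < D + 1 / real (Suc n)" for n
  proof -
    have "Inf ((\<lambda>y. (norm (x - y))\<^sup>2) ` C) < D + 1 / real (Suc n)"
      unfolding D_def by simp
    then show ?thesis
      using bdd assms(3) by (subst (asm) cInf_less_iff) auto
  qed
  then obtain s where s: "\<And>n. s n \<in> C" "\<And>n. (norm (x - s n))\<^sup>2 < D + 1 / real (Suc n)"
    by metis
  have close: "(norm (s j - s k))\<^sup>2 \<le> 2 / real (Suc j) + 2 / real (Suc k)" for j k
  proof -
    have "(1/2) *\<^sub>R s j + (1/2) *\<^sub>R s k \<in> C"
      using assms(1) s(1) by (auto intro: convexD)
    then have "D \<le> (norm (x - ((1/2) *\<^sub>R s j + (1/2) *\<^sub>R s k)))\<^sup>2"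
      by (rule D_le)
    \<comment> \<open>Parallelogram law for \<open>x - s j\<close> and \<open>x - s k\<close>. The
      subtracted term is at least \<open>4 * D\<close>, so the two copies of \<open>2 * D\<close>
      hidden in the other terms cancel.\<close>
    moreover have "(norm (s j - s k))\<^sup>2 = 2 * (norm (x - s j))\<^sup>2 + 2 * (norm (x - s k))\<^sup>2
        - 4 * (norm (x - ((1/2) *\<^sub>R s j + (1/2) *\<^sub>R s k)))\<^sup>2"
      by (simp add: power2_norm_eq_inner algebra_simps inner_commute)
    ultimately show ?thesis
      using s(2)[of j] s(2)[of k] by simp
  qed
  have "Cauchy s"
  proof (rule metric_CauchyI)
    fix e :: real assume "0 < e"
    then obtain N where N: "4 / e\<^sup>2 < real N"
      using reals_Archimedean2 by blast
    have "dist (s j) (s k) < e" if "N \<le> j" "N \<le> k" for j k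
    proof -
      have N1: "4 / real (Suc N) < e\<^sup>2"
        using N \<open>0 < e\<close> by (simp add: field_simps) (smt (verit) zero_less_power)
      have "2 / real (Suc j) \<le> 2 / real (Suc N)" "2 / real (Suc k) \<le> 2 / real (Suc N)"
        using that by (auto intro!: divide_left_mono)
      then have "(norm (s j - s k))\<^sup>2 < e\<^sup>2"
        using close[of j k] N1 by simp
      then show ?thesis
        using \<open>0 < e\<close> by (simp add: dist_norm power_less_imp_less_base)
    qed
    then show "\<exists>M. \<forall>m\<ge>M. \<forall>n\<ge>M. dist (s m) (s n) < e"
      by blast
  qed
  then obtain p where p: "s \<longlonglongrightarrow> p"
    using Cauchy_convergent_iff convergent_def by blast
  have "p \<in> C"
    using closed_sequentially[OF assms(2) _ p] s(1) by blast
  have "(\<lambda>n. (norm (x - s n))\<^sup>2) \<longlonglongrightarrow> (norm (x - p))\<^sup>2"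
    by (intro tendsto_intros p)
  moreover have "(\<lambda>n. D + 1 / real (Suc n)) \<longlonglongrightarrow> D + 0"
    by (intro tendsto_intros LIMSEQ_Suc lim_1_over_n)
  ultimately have "(norm (x - p))\<^sup>2 \<le> D + 0"
    using s(2) by (intro LIMSEQ_le) (auto intro: less_imp_le)
  then have "(norm (x - p))\<^sup>2 \<le> (norm (x - y))\<^sup>2" if "y \<in> C" for y
    using D_le[OF that] by linarith
  then have "norm (x - p) \<le> norm (x - y)" if "y \<in> C" for y
    using power2_le_imp_le[OF _ norm_ge_zero] that by blast
  then show ?thesis
    using \<open>p \<in> C\<close> by (auto simp: dist_norm)
qed

lemma norm_diff_Pythagorean:
  fixes x p y :: "'a::real_inner"
  assumes "inner (x - p) (y - p) = 0"
  shows "(norm (x - y))\<^sup>2 = (norm (x - p))\<^sup>2 + (norm (p - y))\<^sup>2"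
proof -
  have "inner (x - p) (p - y) = - inner (x - p) (y - p)"
    by (simp add: inner_diff_right)
  then show ?thesis
    using norm_add_Pythagorean[of "x - p" "p - y"] assms by (simp add: orthogonal_def)
qed

text \<open>Orthogonality splits the squared distance from \<open>x\<close> to \<open>y\<close>
  through \<open>p\<close>, so any other minimizer is at distance 0 from \<open>p\<close>. As
  \<open>S\<close> is an arbitrary set, this is how projections are identified below: guess the
  point and check orthogonality.\<close>

lemma metric_proj_eqI:
  assumes "p \<in> S" and orth: "\<And>y. y \<in> S \<Longrightarrow> inner (x - p) (y - p) = 0"
  shows "metric_proj S x = p"
  unfolding metric_proj_def
proof (rule the_equality)
  have pyth: "(dist x y)\<^sup>2 = (dist x p)\<^sup>2 + (dist p y)\<^sup>2" if "y \<in> S" for y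
    using norm_diff_Pythagorean[OF orth[OF that]] by (simp add: dist_norm)
  show "p \<in> S \<and> (\<forall>y\<in>S. dist x p \<le> dist x y)"
  proof (intro conjI ballI)
    fix y assume "y \<in> S"
    then show "dist x p \<le> dist x y"
      using pyth[of y] by - (rule power2_le_imp_le, auto)
  qed (rule \<open>p \<in> S\<close>)
  fix q assume q: "q \<in> S \<and> (\<forall>y\<in>S. dist x q \<le> dist x y)"
  then have "(dist x q)\<^sup>2 \<le> (dist x p)\<^sup>2"
    using \<open>p \<in> S\<close> by (simp add: power_mono)
  then have "(dist p q)\<^sup>2 \<le> 0"
    using pyth[of q] q by linarith
  then show "q = p"
    by simp
qed

text \<open>An affine set contains the whole line through the nearest point \<open>p\<close> and any
  other point \<open>y\<close>, so a nonzero inner product could be exploited in either direction to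
  come closer to \<open>x\<close>. Orthogonality is stated for differences \<open>y - z\<close>, the
  vectors of \<open>par S\<close>.\<close>

lemma metric_proj_affine:
  fixes S :: "'a::{real_inner, banach} set"
  assumes "affine S" "closed S" "S \<noteq> {}"
  shows metric_proj_in: "metric_proj S x \<in> S"
    and metric_proj_orthogonal:
      "y \<in> S \<Longrightarrow> z \<in> S \<Longrightarrow> inner (x - metric_proj S x) (y - z) = 0"
proof -
  obtain p where p: "p \<in> S" "\<And>y. y \<in> S \<Longrightarrow> dist x p \<le> dist x y"
    using closest_point_exists[OF affine_imp_convex[OF assms(1)] assms(2,3)] by blast
  have orth: "inner (x - p) (y - p) = 0" if y: "y \<in> S" for y
  proof (rule ccontr)
    assume nz: "inner (x - p) (y - p) \<noteq> 0"
    define n where "n = (norm (y - p))\<^sup>2"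
    have n: "n > 0"
      unfolding n_def using nz by auto
    \<comment> \<open>The minimizer of the quadratic
      \<open>t \<mapsto> (norm (x - p - t *\<^sub>R (y - p)))\<^sup>2\<close>; moving there lowers
      the squared distance by \<open>t * t * n\<close>, contradicting minimality of
      \<open>p\<close>.\<close>
    define t where "t = inner (x - p) (y - p) / n"
    have "(1 - t) *\<^sub>R p + t *\<^sub>R y \<in> S"
      using assms(1) p(1) y by (simp add: affine_def)
    then have "dist x p \<le> dist x ((1 - t) *\<^sub>R p + t *\<^sub>R y)"
      by (rule p(2))
    then have "norm (x - p) \<le> norm (x - p - t *\<^sub>R (y - p))"
      by (simp add: dist_norm algebra_simps)
    then have "(norm (x - p))\<^sup>2 \<le> (norm (x - p - t *\<^sub>R (y - p)))\<^sup>2"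
      by (simp add: power_mono)
    also have "\<dots> = (norm (x - p))\<^sup>2 - 2 * t * inner (x - p) (y - p) + t * t * n"
      unfolding n_def power2_norm_eq_inner inner_diff_left[of "x - p"] inner_diff_right[of _ "x - p"]
      by (simp add: inner_commute[of "y - p" "x - p"] del: inner_diff_left inner_diff_right)
    also have "\<dots> = (norm (x - p))\<^sup>2 - t * t * n"
      using n by (simp add: t_def field_simps)
    finally have "t * t * n \<le> 0"
      by simp
    moreover have "t * t * n > 0"
      using n nz by (auto simp: t_def zero_less_mult_iff linorder_neq_iff)
    ultimately show False
      by simp
  qed
  have eq: "metric_proj S x = p"
    using p(1) orth by (rule metric_proj_eqI)
  show "metric_proj S x \<in> S"
    using eq p(1) by simp
  show "inner (x - metric_proj S x) (y - z) = 0" if "y \<in> S" "z \<in> S"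
    using orth[OF that(1)] orth[OF that(2)] unfolding eq by (simp add: inner_diff_right)
qed

lemma metric_proj_Pythagorean:
  fixes S :: "'a::{real_inner, banach} set"
  assumes "affine S" "closed S" "y \<in> S"
  shows "(norm (x - y))\<^sup>2 = (norm (x - metric_proj S x))\<^sup>2 + (norm (metric_proj S x - y))\<^sup>2"
  using assms metric_proj_affine[of S] by (intro norm_diff_Pythagorean) blast

lemma metric_proj_le:
  fixes S :: "'a::{real_inner, banach} set"
  assumes "affine S" "closed S" "y \<in> S"
  shows "norm (x - metric_proj S x) \<le> norm (x - y)"
  using metric_proj_Pythagorean[OF assms, of x] by - (rule power2_le_imp_le, auto)

lemma metric_proj_id: "x \<in> S \<Longrightarrow> metric_proj S x = x"
  by (rule metric_proj_eqI) auto

text \<open>Both residuals, of \<open>x\<close> on \<open>S\<close> and of \<open>x\<close> on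
  \<open>C\<close>, are orthogonal to differences of points of \<open>C\<close>; hence so is their
  difference \<open>metric_proj S x - metric_proj C x\<close>.\<close>

lemma metric_proj_proj_superset:
  fixes S C :: "'a::{real_inner, banach} set"
  assumes S: "affine S" "closed S" and C: "affine C" "closed C" "C \<noteq> {}" "C \<subseteq> S"
  shows "metric_proj C (metric_proj S x) = metric_proj C x"
proof (rule metric_proj_eqI)
  show "metric_proj C x \<in> C"
    using C by (intro metric_proj_in)
  fix y assume "y \<in> C"
  have "S \<noteq> {}"
    using C by blast
  then have "inner (x - metric_proj S x) (y - metric_proj C x) = 0"
    using \<open>y \<in> C\<close> metric_proj_in[OF C(1-3)] C(4) by (intro metric_proj_orthogonal[OF S]) auto
  moreover have "inner (x - metric_proj C x) (y - metric_proj C x) = 0"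
    using \<open>y \<in> C\<close> metric_proj_in[OF C(1-3)] by (intro metric_proj_orthogonal[OF C(1-3)])
  ultimately show "inner (metric_proj S x - metric_proj C x) (y - metric_proj C x) = 0"
    by (simp add: inner_diff_left)
qed

subsection \<open>Linear regularity\<close>

text \<open>Uniform boundedness principle for the functionals \<open>inner x\<close>,
  \<open>x \<in> S\<close>. The closed sets \<open>F n\<close> cover the space, so by Baire one of
  them contains a ball, and a bound on a ball controls the norms.\<close>

lemma weakly_bounded_imp_bounded:
  fixes S :: "'a::{real_inner, banach} set"
  assumes "\<And>y. \<exists>B. \<forall>x\<in>S. \<bar>inner x y\<bar> \<le> B"
  shows "bounded S"
proof -
  define F where "F n = {y. \<forall>x\<in>S. \<bar>inner x y\<bar> \<le> real n}" for n
  have closed_F: "closed (F n)" for n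
  proof -
    have "F n = (\<Inter>x\<in>S. {y. \<bar>inner x y\<bar> \<le> real n})"
      by (auto simp: F_def)
    then show ?thesis
      by (auto intro!: closed_INT closed_Collect_le continuous_intros)
  qed
  have "\<exists>n. y \<in> F n" for y
  proof -
    obtain B where B: "\<forall>x\<in>S. \<bar>inner x y\<bar> \<le> B"
      using assms by blast
    obtain n where "B \<le> real n"
      using real_arch_simple by blast
    then have "y \<in> F n"
      using B by (auto simp: F_def)
    then show ?thesis ..
  qed
  then have "\<Union> (range F) = UNIV"
    by blast
  then have "\<exists>n. interior (F n) \<noteq> {}"
    using Met_TC.metric_Baire_category_alt[where 'a='a and \<G>="range F"] closed_F
    by (fastforce simp: complete_UNIV)
  then obtain n y where "y \<in> interior (F n)"
    by blast
  then obtain e where e: "e > 0" "cball y e \<subseteq> F n"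
    by (meson mem_interior_cball)
  have "norm x \<le> 2 * real n / e" if x: "x \<in> S" for x
  proof (cases "x = 0")
    case False
    \<comment> \<open>The boundary point of the ball in the direction of \<open>x\<close>: the
      values of \<open>inner x\<close> at \<open>z\<close> and at the center \<open>y\<close> differ
      by exactly \<open>e * norm x\<close>, and both are at most \<open>n\<close> in
      modulus.\<close>
    define z where "z = y + (e / norm x) *\<^sub>R x"
    have "z \<in> cball y e" "y \<in> cball y e"
      using e(1) by (auto simp: z_def dist_norm)
    then have "z \<in> F n" "y \<in> F n"
      using e(2) by blast+
    then have "\<bar>inner x z\<bar> \<le> real n" "\<bar>inner x y\<bar> \<le> real n"
      using x by (auto simp: F_def)
    moreover have "inner x z = inner x y + e * norm x"
      using False by (simp add: z_def inner_add_right power2_norm_eq_inner[symmetric] power2_eq_square)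
    ultimately have "e * norm x \<le> 2 * real n"
      by linarith
    then show ?thesis
      using e(1) by (simp add: field_simps)
  qed (use e(1) in auto)
  then show ?thesis
    unfolding bounded_iff by blast
qed

text \<open>Removes the base point hidden in \<open>par\<close>, giving the same form as the
  orthogonality property of projections.\<close>

lemma orthogonal_comp_par_iff:
  assumes "affine U" "u \<in> U"
  shows "w \<in> (par U)\<^sup>\<bottom> \<longleftrightarrow> (\<forall>y\<in>U. \<forall>z\<in>U. inner (y - z) w = 0)"
proof
  assume w: "w \<in> (par U)\<^sup>\<bottom>"
  have "inner (y - u) w = 0" if "y \<in> U" for y
    using w that unfolding par_eq[OF assms] by (auto simp: orthogonal_comp_def orthogonal_def)
  then show "\<forall>y\<in>U. \<forall>z\<in>U. inner (y - z) w = 0"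
    by (simp add: inner_diff_left)
next
  assume "\<forall>y\<in>U. \<forall>z\<in>U. inner (y - z) w = 0"
  then show "w \<in> (par U)\<^sup>\<bottom>"
    unfolding par_eq[OF assms] using assms(2) by (auto simp: orthogonal_comp_def orthogonal_def)
qed

lemma subspace_sum_set:
  assumes "finite I" "\<And>i. i \<in> I \<Longrightarrow> subspace (S i)"
  shows "subspace (\<Sum>i\<in>I. S i)"
  using assms
proof (induction I rule: finite_induct)
  case (insert i I)
  have "S i + (\<Sum>i\<in>I. S i) = {x + y |x y. x \<in> S i \<and> y \<in> (\<Sum>i\<in>I. S i)}"
    by (auto simp: set_plus_def)
  then show ?case
    using insert by (simp add: subspace_sums)
qed simp

lemma affine_INT:
  assumes "\<And>i. i \<in> I \<Longrightarrow> affine (U i)"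
  shows "affine (\<Inter>i\<in>I. U i)"
  using assms by (auto simp: affine_def)

text \<open>Closedness of the sum \<open>M\<close> allows projecting \<open>y\<close> onto it. The
  projection splits into the \<open>w i\<close> by definition of \<open>M\<close>, and the residual
  \<open>v\<close> is orthogonal to every \<open>(par (U i))\<^sup>\<bottom>\<close>. Closedness of
  each \<open>U i\<close> then makes \<open>v\<close> parallel to \<open>U i\<close>.\<close>

lemma orthogonal_sum_decomposition:
  fixes U :: "'i \<Rightarrow> 'a::{real_inner, banach} set"
  assumes "finite I"
    and aff: "\<And>i. i \<in> I \<Longrightarrow> affine (U i)"
    and cl: "\<And>i. i \<in> I \<Longrightarrow> closed (U i)"
    and p: "p \<in> (\<Inter>i\<in>I. U i)"
    and "closed (\<Sum>i\<in>I. (par (U i))\<^sup>\<bottom>)"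
  obtains v w where "y = v + (\<Sum>i\<in>I. w i)" "p + v \<in> (\<Inter>i\<in>I. U i)"
    "\<And>i. i \<in> I \<Longrightarrow> w i \<in> (par (U i))\<^sup>\<bottom>"
proof -
  define M where "M = (\<Sum>i\<in>I. (par (U i))\<^sup>\<bottom>)"
  have M: "subspace M" "closed M"
    unfolding M_def
    by (intro subspace_sum_set assms(1) subspace_orthogonal_comp assms(5))+
  then have 0: "0 \<in> M" and "affine M" "M \<noteq> {}"
    using subspace_0[OF M(1)] subspace_imp_affine[OF M(1)] by auto
  note projM = metric_proj_affine[OF \<open>affine M\<close> M(2) \<open>M \<noteq> {}\<close>]
  define v where "v = y - metric_proj M y"
  have "metric_proj M y \<in> M"
    by (rule projM)
  then obtain w where w: "metric_proj M y = sum w I" "\<forall>i\<in>I. w i \<in> (par (U i))\<^sup>\<bottom>"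
    unfolding M_def set_sum_alt[OF assms(1)] by blast
  have orth: "inner v z = 0" if "z \<in> M" for z
    using projM(2)[OF that 0, of y] by (simp add: v_def)
  have "p + v \<in> U i" if i: "i \<in> I" for i
  proof -
    have pU: "p \<in> U i"
      using p i by blast
    \<comment> \<open>The residual \<open>p + v - q\<close> lies in
      \<open>(par (U i))\<^sup>\<bottom>\<close>, hence in \<open>M\<close>, so it is orthogonal to
      \<open>v\<close>; it is also orthogonal to \<open>p - q\<close>. Being the sum of these two
      vectors, it vanishes.\<close>
    define q where "q = metric_proj (U i) (p + v)"
    have "U i \<noteq> {}"
      using pU by blast
    note proj = metric_proj_affine[OF aff[OF i] cl[OF i] this]
    have q: "q \<in> U i"
      unfolding q_def by (rule proj)
    have r0: "inner (p + v - q) (a - b) = 0" if "a \<in> U i" "b \<in> U i" for a b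
      unfolding q_def using that by (rule proj)
    have "p + v - q \<in> (par (U i))\<^sup>\<bottom>"
      unfolding orthogonal_comp_par_iff[OF aff[OF i] pU] using r0 by (simp add: inner_commute)
    moreover have "(par (U i))\<^sup>\<bottom> \<subseteq> M"
    proof
      fix z assume z: "z \<in> (par (U i))\<^sup>\<bottom>"
      \<comment> \<open>A single summand space sits inside \<open>M\<close> by choosing 0 in all the
        others.\<close>
      have "z = (\<Sum>j\<in>I. if j = i then z else 0)"
        using i assms(1) by simp
      moreover have "\<forall>j\<in>I. (if j = i then z else 0) \<in> (par (U j))\<^sup>\<bottom>"
        using z by (simp add: subspace_0[OF subspace_orthogonal_comp])
      ultimately show "z \<in> M"
        unfolding M_def set_sum_alt[OF assms(1)] by blast
    qed
    ultimately have "inner v (p + v - q) = 0"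
      using orth by blast
    moreover have "inner (p + v - q) (p - q) = 0"
      using r0[OF pU q] .
    moreover have "inner (p + v - q) (p + v - q) = inner v (p + v - q) + inner (p + v - q) (p - q)"
      by (simp add: algebra_simps inner_commute)
    ultimately have "inner (p + v - q) (p + v - q) = 0"
      by simp
    then have "p + v = q"
      by simp
    then show ?thesis
      using q by simp
  qed
  then show ?thesis
    using that[of v w] w by (auto simp: v_def)
qed

text \<open>The constant is not explicit: it is the square of the bound that uniform boundedness
  yields for the normalized set \<open>S\<close>.\<close>

lemma linear_regularity:
  fixes U :: "'i \<Rightarrow> 'a::{real_inner, banach} set"
  assumes "finite I"
    and aff: "\<And>i. i \<in> I \<Longrightarrow> affine (U i)"
    and cl: "\<And>i. i \<in> I \<Longrightarrow> closed (U i)"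
    and ne: "(\<Inter>i\<in>I. U i) \<noteq> {}"
    and csum: "closed (\<Sum>i\<in>I. (par (U i))\<^sup>\<bottom>)"
  obtains \<kappa> where "\<kappa> > 0"
    "\<And>x. (norm (x - metric_proj (\<Inter>i\<in>I. U i) x))\<^sup>2
      \<le> \<kappa> * (\<Sum>i\<in>I. (norm (x - metric_proj (U i) x))\<^sup>2)"
proof -
  define C where "C = (\<Inter>i\<in>I. U i)"
  have C: "affine C" "closed C" "C \<noteq> {}"
    using aff cl ne by (auto simp: C_def affine_INT)
  define s where "s x = (\<Sum>i\<in>I. (norm (x - metric_proj (U i) x))\<^sup>2)" for x
  have s_nonneg: "s x \<ge> 0" for x
    by (simp add: s_def sum_nonneg)
  \<comment> \<open>Scaling by every \<open>t\<close> with \<open>t\<^sup>2 * s x \<le> 1\<close>,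
    instead of dividing by \<open>sqrt (s x)\<close>, also covers \<open>s x = 0\<close>, where all
    multiples belong to \<open>S\<close>.\<close>
  define S where "S = {t *\<^sub>R (x - metric_proj C x) | t x. t\<^sup>2 * s x \<le> 1}"
  have "\<exists>B. \<forall>z\<in>S. \<bar>inner z y\<bar> \<le> B" for y
  proof -
    obtain p where p: "p \<in> (\<Inter>i\<in>I. U i)"
      using ne by blast
    obtain v w where vw: "y = v + (\<Sum>i\<in>I. w i)" "p + v \<in> (\<Inter>i\<in>I. U i)"
        "\<And>i. i \<in> I \<Longrightarrow> w i \<in> (par (U i))\<^sup>\<bottom>"
      using orthogonal_sum_decomposition[OF assms(1) aff cl p csum] by blast
    \<comment> \<open>The bound depends on \<open>y\<close> alone, through its decomposition. The
      part \<open>v\<close> contributes nothing, and Cauchy-Schwarz handles each \<open>w i\<close>,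
      since every scaled residual on \<open>U i\<close> has norm at most 1.\<close>
    have "\<bar>inner (t *\<^sub>R (x - metric_proj C x)) y\<bar> \<le> (\<Sum>i\<in>I. norm (w i))"
      if t: "t\<^sup>2 * s x \<le> 1" for t x
    proof -
      have PC: "metric_proj C x \<in> C"
        using C by (rule metric_proj_in)
      have "inner (x - metric_proj C x) v = 0"
        using metric_proj_orthogonal[OF C, of "p + v" p x] vw(2) p by (simp add: C_def)
      \<comment> \<open>\<open>metric_proj (U i) x\<close> and \<open>metric_proj C x\<close> both
        lie in \<open>U i\<close>, so \<open>w i\<close> annihilates their difference.\<close>
      moreover have "inner (x - metric_proj C x) (w i) = inner (x - metric_proj (U i) x) (w i)"
        if i: "i \<in> I" for i
      proof -
        have PCi: "metric_proj C x \<in> U i"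
          using PC i by (simp add: C_def)
        then have "metric_proj (U i) x \<in> U i"
          using metric_proj_in[OF aff[OF i] cl[OF i]] by blast
        then have "inner (metric_proj (U i) x - metric_proj C x) (w i) = 0"
          using vw(3)[OF i] orthogonal_comp_par_iff[OF aff[OF i] PCi] PCi by blast
        then show ?thesis
          by (simp add: inner_diff_left)
      qed
      ultimately have eq: "inner (t *\<^sub>R (x - metric_proj C x)) y
          = (\<Sum>i\<in>I. inner (t *\<^sub>R (x - metric_proj (U i) x)) (w i))"
        by (simp add: vw(1) inner_add_right inner_sum_right sum_distrib_left)
      have "norm (t *\<^sub>R (x - metric_proj (U i) x)) \<le> 1" if i: "i \<in> I" for i
      proof -
        have "(norm (x - metric_proj (U i) x))\<^sup>2 \<le> s x"
          unfolding s_def using assms(1) i by (intro member_le_sum) auto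
        then have "t\<^sup>2 * (norm (x - metric_proj (U i) x))\<^sup>2 \<le> t\<^sup>2 * s x"
          by (simp add: mult_left_mono)
        then have "(norm (t *\<^sub>R (x - metric_proj (U i) x)))\<^sup>2 \<le> 1\<^sup>2"
          using t by (simp add: power_mult_distrib)
        then show ?thesis
          by (rule power2_le_imp_le) simp
      qed
      then have "\<bar>inner (t *\<^sub>R (x - metric_proj (U i) x)) (w i)\<bar> \<le> norm (w i)" if "i \<in> I" for i
        using that by (meson Cauchy_Schwarz_ineq2 mult_left_le_one_le norm_ge_zero order_trans)
      then show ?thesis
        unfolding eq by (intro order_trans[OF sum_abs] sum_mono)
    qed
    then show ?thesis
      unfolding S_def by blast
  qed
  then have "bounded S"
    by (rule weakly_bounded_imp_bounded)
  then obtain B where B: "B > 0" "\<And>z. z \<in> S \<Longrightarrow> norm z \<le> B"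
    unfolding bounded_pos by blast
  have "(norm (x - metric_proj C x))\<^sup>2 \<le> B\<^sup>2 * s x" for x
  proof (cases "s x = 0")
    case True
    have "norm (x - metric_proj C x) \<le> 0"
    proof (rule ccontr)
      assume "\<not> norm (x - metric_proj C x) \<le> 0"
      then have n: "norm (x - metric_proj C x) > 0"
        by simp
      \<comment> \<open>A multiple of norm \<open>B + 1\<close>, too long for the bound
        \<open>B\<close> on \<open>S\<close>.\<close>
      have "((B + 1) / norm (x - metric_proj C x)) *\<^sub>R (x - metric_proj C x) \<in> S"
        unfolding S_def using True by fastforce
      then show False
        using B(2) n B(1) by fastforce
    qed
    then show ?thesis
      using True by simp
  next
    case False
    then have pos: "s x > 0"
      using s_nonneg[of x] by simp
    have "(1 / sqrt (s x)) *\<^sub>R (x - metric_proj C x) \<in> S"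
      unfolding S_def using pos by (auto intro!: exI[of _ "1 / sqrt (s x)"] exI[of _ x] simp: power_divide)
    then have "norm ((1 / sqrt (s x)) *\<^sub>R (x - metric_proj C x)) \<le> B"
      by (rule B(2))
    then have "norm (x - metric_proj C x) \<le> B * sqrt (s x)"
      using pos by (simp add: pos_divide_le_eq del: scaleR_diff_right scaleR_right_diff_distrib)
    then have "(norm (x - metric_proj C x))\<^sup>2 \<le> (B * sqrt (s x))\<^sup>2"
      by (simp add: power_mono)
    then show ?thesis
      using pos by (simp add: power_mult_distrib)
  qed
  then show thesis
    using B(1) unfolding C_def s_def by (intro that[of "B\<^sup>2"]) simp_all
qed

subsection \<open>Contraction towards the intersection\<close>

text \<open>Since \<open>\<gamma> < 1\<close>, the contraction estimate at a fixed point forces it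
  into \<open>C\<close>, so \<open>Fix G = C\<close>. All iterates have the same projection onto
  \<open>C\<close>, so the one-step estimate can be repeated with an unchanged target.\<close>

lemma BAM_with_linear_convergence:
  fixes G :: "'a::{real_inner, banach} \<Rightarrow> 'a"
  assumes C: "affine C" "closed C" "C \<noteq> {}"
    and \<gamma>: "0 \<le> \<gamma>" "\<gamma> < 1"
    and fixed: "\<And>x. x \<in> C \<Longrightarrow> G x = x"
    and proj: "\<And>x. metric_proj C (G x) = metric_proj C x"
    and contr: "\<And>x. norm (G x - metric_proj C x) \<le> \<gamma> * norm (x - metric_proj C x)"
  shows "BAM_with \<gamma> G"
    and "norm ((G ^^ k) x - metric_proj C x) \<le> \<gamma> ^ k * norm (x - metric_proj C x)"
proof -
  have "Fix G = C"
  proof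
    show "C \<subseteq> Fix G"
      using fixed by (auto simp: Fix_def)
    show "Fix G \<subseteq> C"
    proof
      fix x assume "x \<in> Fix G"
      then have "norm (x - metric_proj C x) \<le> \<gamma> * norm (x - metric_proj C x)"
        using contr[of x] by (simp add: Fix_def)
      then have "(1 - \<gamma>) * norm (x - metric_proj C x) \<le> 0"
        by (simp add: algebra_simps)
      then have "x = metric_proj C x"
        using \<gamma>(2) by (simp add: mult_le_0_iff)
      then show "x \<in> C"
        using metric_proj_in[OF C, of x] by simp
    qed
  qed
  then show "BAM_with \<gamma> G"
    using C \<gamma> proj contr by (auto simp: BAM_with_def affine_imp_convex)
  have projk: "metric_proj C ((G ^^ k) x) = metric_proj C x" for k
    by (induction k) (auto simp: proj)
  show "norm ((G ^^ k) x - metric_proj C x) \<le> \<gamma> ^ k * norm (x - metric_proj C x)"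
  proof (induction k)
    case (Suc k)
    have "norm ((G ^^ Suc k) x - metric_proj C x) \<le> \<gamma> * norm ((G ^^ k) x - metric_proj C x)"
      using contr[of "(G ^^ k) x"] by (simp add: projk)
    also have "\<dots> \<le> \<gamma> * (\<gamma> ^ k * norm (x - metric_proj C x))"
      using Suc \<gamma>(1) by (rule mult_left_mono)
    finally show ?case
      by (simp add: mult.assoc)
  qed simp
qed

text \<open>Common core of both claims: the bound \<open>K\<close> says that one step of
  \<open>G\<close> gains at least a fixed share of the squared distances to the \<open>U i\<close>,
  and by linear regularity this is a fixed share of the squared distance to the
  intersection.\<close>

lemma BAM_linear_convergence_if_regular:
  fixes U :: "'i \<Rightarrow> 'a::{real_inner, banach} set"
  assumes fin: "finite I"
    and aff: "\<And>i. i \<in> I \<Longrightarrow> affine (U i)"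
    and cl: "\<And>i. i \<in> I \<Longrightarrow> closed (U i)"
    and ne: "(\<Inter>i\<in>I. U i) \<noteq> {}"
    and csum: "closed (\<Sum>i\<in>I. (par (U i))\<^sup>\<bottom>)"
    and fixed: "\<And>x. x \<in> (\<Inter>i\<in>I. U i) \<Longrightarrow> G x = x"
    and proj: "\<And>x. metric_proj (\<Inter>i\<in>I. U i) (G x) = metric_proj (\<Inter>i\<in>I. U i) x"
    and K: "K > 0" "\<And>x. (\<Sum>i\<in>I. (norm (x - metric_proj (U i) x))\<^sup>2) \<le>
      K * ((norm (x - metric_proj (\<Inter>i\<in>I. U i) x))\<^sup>2 - (norm (G x - metric_proj (\<Inter>i\<in>I. U i) x))\<^sup>2)"
  shows "BAM G \<and> (\<exists>\<gamma>::real. 0 \<le> \<gamma> \<and> \<gamma> < 1 \<and> (\<forall>x. \<forall>k::nat.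
    norm ((G ^^ k) x - metric_proj (\<Inter>i\<in>I. U i) x)
      \<le> \<gamma> ^ k * norm (x - metric_proj (\<Inter>i\<in>I. U i) x)))"
proof -
  define C where "C = (\<Inter>i\<in>I. U i)"
  have C: "affine C" "closed C" "C \<noteq> {}"
    using aff cl ne by (auto simp: C_def affine_INT)
  obtain \<kappa> where \<kappa>: "\<kappa> > 0" "\<And>x. (norm (x - metric_proj C x))\<^sup>2
      \<le> \<kappa> * (\<Sum>i\<in>I. (norm (x - metric_proj (U i) x))\<^sup>2)"
    using linear_regularity[OF fin aff cl ne csum, folded C_def] by metis
  \<comment> \<open>From \<open>a \<le> \<kappa> * K * (a - b) \<le> L * (a - b)\<close> follows
    \<open>b \<le> (1 - 1 / L) * a\<close>. The added 1 ensures \<open>L > 1\<close>, so that the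
    square root below is real and less than 1.\<close>
  define L where "L = \<kappa> * K + 1"
  have L: "L > 1"
    using \<kappa>(1) K(1) by (simp add: L_def)
  define \<gamma> where "\<gamma> = sqrt (1 - 1 / L)"
  have \<gamma>: "0 \<le> \<gamma>" "\<gamma> < 1"
    using L by (auto simp: \<gamma>_def)
  have "norm (G x - metric_proj C x) \<le> \<gamma> * norm (x - metric_proj C x)" for x
  proof (rule power2_le_imp_le)
    define a b where "a = (norm (x - metric_proj C x))\<^sup>2" and "b = (norm (G x - metric_proj C x))\<^sup>2"
    have "0 \<le> K * (a - b)"
      using K(2)[of x] sum_nonneg[of I "\<lambda>i. (norm (x - metric_proj (U i) x))\<^sup>2"]
      unfolding a_def b_def C_def by simp
    then have ab: "0 \<le> a - b"
      using K(1) by (simp add: zero_le_mult_iff)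
    have "a \<le> \<kappa> * (K * (a - b))"
      using \<kappa>(2)[of x] K(2)[of x] \<kappa>(1) unfolding a_def b_def C_def
      by (meson less_imp_le mult_left_mono order_trans)
    also have "\<dots> \<le> L * (a - b)"
      using ab by (simp add: L_def algebra_simps)
    finally have "b \<le> (1 - 1 / L) * a"
      using L by (simp add: field_simps)
    then show "(norm (G x - metric_proj C x))\<^sup>2 \<le> (\<gamma> * norm (x - metric_proj C x))\<^sup>2"
      using L by (simp add: a_def b_def \<gamma>_def power_mult_distrib)
    show "0 \<le> \<gamma> * norm (x - metric_proj C x)"
      using \<gamma> by simp
  qed
  then have "BAM_with \<gamma> G"
    and "norm ((G ^^ k) x - metric_proj C x) \<le> \<gamma> ^ k * norm (x - metric_proj C x)" for k x
    using BAM_with_linear_convergence[of C \<gamma> G, OF C \<gamma>] fixed proj unfolding C_def by blast+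
  then show ?thesis
    using \<gamma> unfolding BAM_def C_def by blast
qed

section \<open>Compositions of projections\<close>

lemma cyclic_proj_0 [simp]: "cyclic_proj U 0 x = x"
  by (simp add: cyclic_proj_def)

lemma cyclic_proj_Suc [simp]:
  "cyclic_proj U (Suc n) x = metric_proj (U (Suc n)) (cyclic_proj U n x)"
  by (simp add: cyclic_proj_def)

lemma cyclic_proj_fixed:
  assumes "x \<in> (\<Inter>i\<in>{1..n}. U i)"
  shows "cyclic_proj U n x = x"
  using assms by (induction n) (auto simp: metric_proj_id)

lemma metric_proj_cyclic_proj:
  fixes U :: "nat \<Rightarrow> 'a::{real_inner, banach} set"
  assumes "\<And>i. i \<in> {1..n} \<Longrightarrow> affine (U i)" "\<And>i. i \<in> {1..n} \<Longrightarrow> closed (U i)"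
    and "affine C" "closed C" "C \<noteq> {}" "\<And>i. i \<in> {1..n} \<Longrightarrow> C \<subseteq> U i"
  shows "metric_proj C (cyclic_proj U n x) = metric_proj C x"
  using assms by (induction n) (simp_all add: metric_proj_proj_superset)

lemma norm_add_squared_le:
  fixes a b :: "'a::real_inner"
  shows "(norm (a + b))\<^sup>2 \<le> 2 * (norm a)\<^sup>2 + 2 * (norm b)\<^sup>2"
proof -
  have "0 \<le> (norm (a - b))\<^sup>2"
    by simp
  then show ?thesis
    by (simp add: power2_norm_eq_inner algebra_simps inner_commute)
qed

text \<open>By Pythagoras each projection lowers the squared distance to the common point
  \<open>p\<close> by the square of its own displacement. Accumulating displacements with
  \<open>norm_add_squared_le\<close> costs a factor 2 per step, whence \<open>2 ^ n\<close>. The two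
  bounds are proved together because the first one yields the new index in the second.\<close>

lemma cyclic_proj_displacement:
  fixes U :: "nat \<Rightarrow> 'a::{real_inner, banach} set"
  assumes "\<And>i. i \<in> {1..n} \<Longrightarrow> affine (U i)" "\<And>i. i \<in> {1..n} \<Longrightarrow> closed (U i)"
    and "\<And>i. i \<in> {1..n} \<Longrightarrow> p \<in> U i"
  shows "(norm (x - cyclic_proj U n x))\<^sup>2
      \<le> 2 ^ n * ((norm (x - p))\<^sup>2 - (norm (cyclic_proj U n x - p))\<^sup>2)"
    and "i \<in> {1..n} \<Longrightarrow> (norm (x - metric_proj (U i) x))\<^sup>2
      \<le> 2 ^ n * ((norm (x - p))\<^sup>2 - (norm (cyclic_proj U n x - p))\<^sup>2)"
proof -
  have "(norm (x - cyclic_proj U n x))\<^sup>2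
        \<le> 2 ^ n * ((norm (x - p))\<^sup>2 - (norm (cyclic_proj U n x - p))\<^sup>2)
    \<and> (\<forall>i\<in>{1..n}. (norm (x - metric_proj (U i) x))\<^sup>2
        \<le> 2 ^ n * ((norm (x - p))\<^sup>2 - (norm (cyclic_proj U n x - p))\<^sup>2))"
    using assms
  proof (induction n)
    case (Suc n)
    let ?y = "cyclic_proj U n x" and ?z = "cyclic_proj U (Suc n) x"
    have U: "affine (U (Suc n))" "closed (U (Suc n))" "p \<in> U (Suc n)"
      using Suc.prems by auto
    have IH: "(norm (x - ?y))\<^sup>2 \<le> 2 ^ n * ((norm (x - p))\<^sup>2 - (norm (?y - p))\<^sup>2)"
      "\<And>i. i \<in> {1..n} \<Longrightarrow> (norm (x - metric_proj (U i) x))\<^sup>2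
        \<le> 2 ^ n * ((norm (x - p))\<^sup>2 - (norm (?y - p))\<^sup>2)"
      using Suc.IH Suc.prems by auto
    have pyth: "(norm (?y - p))\<^sup>2 = (norm (?y - ?z))\<^sup>2 + (norm (?z - p))\<^sup>2"
      using metric_proj_Pythagorean[OF U, of ?y] by simp
    have "0 \<le> 2 ^ n * ((norm (x - p))\<^sup>2 - (norm (?y - p))\<^sup>2)"
      using IH(1) by (meson order_trans zero_le_power2)
    then have nonneg: "0 \<le> (norm (x - p))\<^sup>2 - (norm (?y - p))\<^sup>2"
      using zero_less_power[of "2::real" n] by (simp add: zero_le_mult_iff del: zero_less_power)
    \<comment> \<open>By \<open>pyth\<close> the gap grows by
      \<open>(norm (?y - ?z))\<^sup>2\<close>, which enters the right side with factor
      \<open>2 * 2 ^ n \<ge> 2\<close>.\<close>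
    have step: "2 * (2 ^ n * ((norm (x - p))\<^sup>2 - (norm (?y - p))\<^sup>2)) + 2 * (norm (?y - ?z))\<^sup>2
        \<le> 2 ^ Suc n * ((norm (x - p))\<^sup>2 - (norm (?z - p))\<^sup>2)"
    proof -
      have "1 * (norm (?y - ?z))\<^sup>2 \<le> 2 ^ n * (norm (?y - ?z))\<^sup>2"
        by (intro mult_right_mono) auto
      then show ?thesis
        by (simp add: pyth algebra_simps)
    qed
    have 1: "(norm (x - ?z))\<^sup>2 \<le> 2 ^ Suc n * ((norm (x - p))\<^sup>2 - (norm (?z - p))\<^sup>2)"
    proof -
      have "(x - ?y) + (?y - ?z) = x - ?z"
        by simp
      then show ?thesis
        using norm_add_squared_le[of "x - ?y" "?y - ?z"] IH(1) step by (simp only:)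
    qed
    have "(norm (x - metric_proj (U i) x))\<^sup>2
        \<le> 2 ^ Suc n * ((norm (x - p))\<^sup>2 - (norm (?z - p))\<^sup>2)" if i: "i \<in> {1..Suc n}" for i
    proof (cases "i = Suc n")
      case True
      \<comment> \<open>The distance from \<open>x\<close> to \<open>U (Suc n)\<close> is at most
        the distance to the point \<open>?z\<close> of it, which \<open>1\<close> bounds.\<close>
      have "?z \<in> U (Suc n)"
        using metric_proj_in[OF U(1,2)] U(3) by auto
      then have "norm (x - metric_proj (U i) x) \<le> norm (x - ?z)"
        unfolding True by (rule metric_proj_le[OF U(1,2)])
      then show ?thesis
        using 1 power_mono[of "norm (x - metric_proj (U i) x)" "norm (x - ?z)" 2]
        by (meson norm_ge_zero order_trans)
    next
      case False
      then have "(norm (x - metric_proj (U i) x))\<^sup>2 \<le> 2 ^ n * ((norm (x - p))\<^sup>2 - (norm (?y - p))\<^sup>2)"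
        using i by (intro IH(2)) auto
      moreover have "0 \<le> 2 ^ n * ((norm (x - p))\<^sup>2 - (norm (?y - p))\<^sup>2)"
        using nonneg by simp
      moreover have "0 \<le> (norm (?y - ?z))\<^sup>2"
        by simp
      ultimately show ?thesis
        using step by linarith
    qed
    with 1 show ?case
      by blast
  qed auto
  then show "(norm (x - cyclic_proj U n x))\<^sup>2
      \<le> 2 ^ n * ((norm (x - p))\<^sup>2 - (norm (cyclic_proj U n x - p))\<^sup>2)"
    and "i \<in> {1..n} \<Longrightarrow> (norm (x - metric_proj (U i) x))\<^sup>2
      \<le> 2 ^ n * ((norm (x - p))\<^sup>2 - (norm (cyclic_proj U n x - p))\<^sup>2)"
    by blast+
qed

section \<open>Weighted averages of projections\<close>

lemma norm_convex_combination_squared_le: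
  fixes f :: "'i \<Rightarrow> 'a::real_inner"
  assumes "finite I" "\<And>i. i \<in> I \<Longrightarrow> 0 \<le> \<omega> i" "sum \<omega> I = 1"
  shows "(norm (\<Sum>i\<in>I. \<omega> i *\<^sub>R f i))\<^sup>2 \<le> (\<Sum>i\<in>I. \<omega> i * (norm (f i))\<^sup>2)"
proof -
  have "norm (\<Sum>i\<in>I. \<omega> i *\<^sub>R f i) \<le> (\<Sum>i\<in>I. norm (\<omega> i *\<^sub>R f i))"
    by (rule norm_sum)
  also have "\<dots> = (\<Sum>i\<in>I. \<omega> i * norm (f i))"
    using assms(2) by simp
  finally have "(norm (\<Sum>i\<in>I. \<omega> i *\<^sub>R f i))\<^sup>2 \<le> (\<Sum>i\<in>I. \<omega> i * norm (f i))\<^sup>2"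
    by (simp add: power_mono)
  \<comment> \<open>Jensen's inequality for the real square function at the norms.\<close>
  also have "\<dots> \<le> (\<Sum>i\<in>I. \<omega> i * (norm (f i))\<^sup>2)"
    using convex_on_sum[OF assms(1) _ convex_power2 assms(3), of "\<lambda>i. norm (f i)"] assms
    by fastforce
  finally show ?thesis .
qed

lemma averaged_proj_diff:
  assumes "(\<Sum>i=1..n. \<omega> i) = 1"
  shows "averaged_proj \<omega> U n x - p = (\<Sum>i=1..n. \<omega> i *\<^sub>R (metric_proj (U i) x - p))"
proof -
  have "(\<Sum>i=1..n. \<omega> i *\<^sub>R p) = p"
    using assms by (simp only: scaleR_sum_left[symmetric] scaleR_one)
  then show ?thesis
    by (simp only: averaged_proj_def scaleR_diff_right sum_subtractf)
qed

text \<open>Every \<open>metric_proj (U i) x\<close> has the same projection onto \<open>C\<close>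
  as \<open>x\<close>. The resulting orthogonality relations are linear and survive the weighted
  sum.\<close>

lemma metric_proj_averaged_proj:
  fixes U :: "nat \<Rightarrow> 'a::{real_inner, banach} set"
  assumes U: "\<And>i. i \<in> {1..n} \<Longrightarrow> affine (U i)" "\<And>i. i \<in> {1..n} \<Longrightarrow> closed (U i)"
    and C: "affine C" "closed C" "C \<noteq> {}" and sub: "\<And>i. i \<in> {1..n} \<Longrightarrow> C \<subseteq> U i"
    and \<omega>: "(\<Sum>i=1..n. \<omega> i) = 1"
  shows "metric_proj C (averaged_proj \<omega> U n x) = metric_proj C x"
proof (rule metric_proj_eqI)
  show "metric_proj C x \<in> C"
    using C by (rule metric_proj_in)
  fix y assume y: "y \<in> C"
  have "inner (metric_proj (U i) x - metric_proj C x) (y - metric_proj C x) = 0"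
    if i: "i \<in> {1..n}" for i
    using metric_proj_orthogonal[OF C y metric_proj_in[OF C, of x], of "metric_proj (U i) x"]
      metric_proj_proj_superset[OF U[OF i] C sub[OF i]] by simp
  then show "inner (averaged_proj \<omega> U n x - metric_proj C x) (y - metric_proj C x) = 0"
    unfolding averaged_proj_diff[OF \<omega>] by (simp add: inner_sum_left)
qed

text \<open>Convexity of the squared norm reduces the claim to the single projections, where
  Pythagoras is exact; the weights sum to 1, so the terms in \<open>x - p\<close> recombine.\<close>

lemma averaged_proj_displacement:
  fixes U :: "nat \<Rightarrow> 'a::{real_inner, banach} set"
  assumes U: "\<And>i. i \<in> {1..n} \<Longrightarrow> affine (U i)" "\<And>i. i \<in> {1..n} \<Longrightarrow> closed (U i)"
    and p: "\<And>i. i \<in> {1..n} \<Longrightarrow> p \<in> U i"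
    and \<omega>: "\<And>i. i \<in> {1..n} \<Longrightarrow> 0 \<le> \<omega> i" "(\<Sum>i=1..n. \<omega> i) = 1"
  shows "(\<Sum>i=1..n. \<omega> i * (norm (x - metric_proj (U i) x))\<^sup>2)
    \<le> (norm (x - p))\<^sup>2 - (norm (averaged_proj \<omega> U n x - p))\<^sup>2"
proof -
  have "(norm (averaged_proj \<omega> U n x - p))\<^sup>2 \<le> (\<Sum>i=1..n. \<omega> i * (norm (metric_proj (U i) x - p))\<^sup>2)"
    unfolding averaged_proj_diff[OF \<omega>(2)] using \<omega>
    by (intro norm_convex_combination_squared_le) auto
  also have "\<dots> = (\<Sum>i=1..n. \<omega> i * (norm (x - p))\<^sup>2 - \<omega> i * (norm (x - metric_proj (U i) x))\<^sup>2)"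
  proof (intro sum.cong refl)
    fix i assume i: "i \<in> {1..n}"
    show "\<omega> i * (norm (metric_proj (U i) x - p))\<^sup>2
        = \<omega> i * (norm (x - p))\<^sup>2 - \<omega> i * (norm (x - metric_proj (U i) x))\<^sup>2"
      unfolding metric_proj_Pythagorean[OF U[OF i] p[OF i], of x] by (simp add: distrib_left)
  qed
  also have "\<dots> = (norm (x - p))\<^sup>2 - (\<Sum>i=1..n. \<omega> i * (norm (x - metric_proj (U i) x))\<^sup>2)"
    by (simp only: sum_subtractf sum_distrib_right[symmetric] \<omega>(2) mult_1)
  finally show ?thesis
    by simp
qed

section \<open>Both convergence claims from the displacement bounds\<close>

theorem corollary5p12:
  fixes U :: "nat \<Rightarrow> 'a::{real_inner, banach} set" and m :: nat
  assumes "m \<ge> 1"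
    and "\<And>i. i \<in> {1..m} \<Longrightarrow> affine (U i)"
    and "\<And>i. i \<in> {1..m} \<Longrightarrow> closed (U i)"
    and "(\<Inter>i\<in>{1..m}. U i) \<noteq> {}"
  shows
    "((\<forall>i\<in>{1..m}. closed (\<Sum>j=1..i. (par (U j))\<^sup>\<bottom>)) \<longrightarrow>
        BAM (cyclic_proj U m) \<and>
        (\<exists>\<gamma>::real. 0 \<le> \<gamma> \<and> \<gamma> < 1 \<and>
          (\<forall>x. \<forall>k::nat.
            norm ((cyclic_proj U m ^^ k) x - metric_proj (\<Inter>i\<in>{1..m}. U i) x)
              \<le> \<gamma> ^ k * norm (x - metric_proj (\<Inter>i\<in>{1..m}. U i) x))))
     \<and>
     (closed (\<Sum>i=1..m. (par (U i))\<^sup>\<bottom>) \<longrightarrow>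
        (\<forall>\<omega>::nat \<Rightarrow> real.
          (\<forall>i\<in>{1..m}. 0 < \<omega> i \<and> \<omega> i \<le> 1) \<and> (\<Sum>i=1..m. \<omega> i) = 1 \<longrightarrow>
          BAM (averaged_proj \<omega> U m) \<and>
          (\<exists>\<gamma>::real. 0 \<le> \<gamma> \<and> \<gamma> < 1 \<and>
            (\<forall>x. \<forall>k::nat.
              norm ((averaged_proj \<omega> U m ^^ k) x - metric_proj (\<Inter>i\<in>{1..m}. U i) x)
                \<le> \<gamma> ^ k * norm (x - metric_proj (\<Inter>i\<in>{1..m}. U i) x)))))"
proof (intro conjI impI allI)
  define C where "C = (\<Inter>i\<in>{1..m}. U i)"
  have C: "affine C" "closed C" "C \<noteq> {}"
    using assms by (auto simp: C_def affine_INT)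
  have sub: "C \<subseteq> U i" if "i \<in> {1..m}" for i
    using that by (auto simp: C_def)
  have PC: "metric_proj C x \<in> U i" if "i \<in> {1..m}" for i x
    using metric_proj_in[OF C] sub[OF that] by blast
  note bam = BAM_linear_convergence_if_regular[OF finite_atLeastAtMost assms(2-4)]
  {
    assume "\<forall>i\<in>{1..m}. closed (\<Sum>j=1..i. (par (U j))\<^sup>\<bottom>)"
    \<comment> \<open>The instance \<open>i = m\<close>, in range because
      \<open>m \<ge> 1\<close>.\<close>
    then have cl: "closed (\<Sum>j=1..m. (par (U j))\<^sup>\<bottom>)"
      using assms(1) by simp
    have "BAM (cyclic_proj U m) \<and> (\<exists>\<gamma>::real. 0 \<le> \<gamma> \<and> \<gamma> < 1 \<and> (\<forall>x. \<forall>k::nat.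
      norm ((cyclic_proj U m ^^ k) x - metric_proj (\<Inter>i\<in>{1..m}. U i) x)
        \<le> \<gamma> ^ k * norm (x - metric_proj (\<Inter>i\<in>{1..m}. U i) x)))"
    proof (rule bam[OF _ _ cl])
      show "cyclic_proj U m x = x" if "x \<in> (\<Inter>i\<in>{1..m}. U i)" for x
        using that by (rule cyclic_proj_fixed)
      show "metric_proj (\<Inter>i\<in>{1..m}. U i) (cyclic_proj U m x) = metric_proj (\<Inter>i\<in>{1..m}. U i) x" for x
        unfolding C_def[symmetric] using assms(2,3) C sub by (rule metric_proj_cyclic_proj)
      \<comment> \<open>\<open>K\<close> is \<open>m\<close> times the bound \<open>2 ^ m\<close>
        that holds for each of the \<open>m\<close> squared distances, with \<open>p\<close> taken
        as the projection of \<open>x\<close> onto \<open>C\<close>.\<close>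
      show "0 < real m * 2 ^ m"
        using assms(1) by simp
      show "(\<Sum>i=1..m. (norm (x - metric_proj (U i) x))\<^sup>2) \<le> real m * 2 ^ m *
          ((norm (x - metric_proj (\<Inter>i\<in>{1..m}. U i) x))\<^sup>2
            - (norm (cyclic_proj U m x - metric_proj (\<Inter>i\<in>{1..m}. U i) x))\<^sup>2)" for x
        unfolding C_def[symmetric]
        using sum_bounded_above[of "{1..m}", OF cyclic_proj_displacement(2)[OF assms(2,3) PC]]
        by (simp add: mult.assoc)
    qed simp_all
  }
  note cyclic = this
  show "BAM (cyclic_proj U m)" if "\<forall>i\<in>{1..m}. closed (\<Sum>j=1..i. (par (U j))\<^sup>\<bottom>)"
    using cyclic[OF that] by blast
  show "\<exists>\<gamma>::real. 0 \<le> \<gamma> \<and> \<gamma> < 1 \<and> (\<forall>x. \<forall>k::nat.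
      norm ((cyclic_proj U m ^^ k) x - metric_proj (\<Inter>i\<in>{1..m}. U i) x)
        \<le> \<gamma> ^ k * norm (x - metric_proj (\<Inter>i\<in>{1..m}. U i) x))"
    if "\<forall>i\<in>{1..m}. closed (\<Sum>j=1..i. (par (U j))\<^sup>\<bottom>)"
    using cyclic[OF that] by blast
  {
    fix \<omega> :: "nat \<Rightarrow> real"
    assume cl: "closed (\<Sum>i=1..m. (par (U i))\<^sup>\<bottom>)"
      and w: "(\<forall>i\<in>{1..m}. 0 < \<omega> i \<and> \<omega> i \<le> 1) \<and> (\<Sum>i=1..m. \<omega> i) = 1"
    \<comment> \<open>The smallest weight, positive as a minimum over a finite nonempty index set.
      Replacing every weight by it gives \<open>K = 1 / \<mu>\<close>.\<close>
    define \<mu> where "\<mu> = Min (\<omega> ` {1..m})"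
    have \<mu>: "\<mu> > 0" "\<And>i. i \<in> {1..m} \<Longrightarrow> \<mu> \<le> \<omega> i"
      using w assms(1) by (auto simp: \<mu>_def)
    have "BAM (averaged_proj \<omega> U m) \<and> (\<exists>\<gamma>::real. 0 \<le> \<gamma> \<and> \<gamma> < 1 \<and> (\<forall>x. \<forall>k::nat.
      norm ((averaged_proj \<omega> U m ^^ k) x - metric_proj (\<Inter>i\<in>{1..m}. U i) x)
        \<le> \<gamma> ^ k * norm (x - metric_proj (\<Inter>i\<in>{1..m}. U i) x)))"
    proof (rule bam[OF _ _ cl])
      show "averaged_proj \<omega> U m x = x" if "x \<in> (\<Inter>i\<in>{1..m}. U i)" for x
        using averaged_proj_diff[of \<omega> m U x x] w that by (simp add: metric_proj_id)
      show "metric_proj (\<Inter>i\<in>{1..m}. U i) (averaged_proj \<omega> U m x) = metric_proj (\<Inter>i\<in>{1..m}. U i) x" for x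
        unfolding C_def[symmetric] using assms(2,3) C sub conjunct2[OF w]
        by (rule metric_proj_averaged_proj)
      show "0 < 1 / \<mu>"
        using \<mu> by simp
      fix x
      have "\<mu> * (\<Sum>i=1..m. (norm (x - metric_proj (U i) x))\<^sup>2)
          \<le> (\<Sum>i=1..m. \<omega> i * (norm (x - metric_proj (U i) x))\<^sup>2)"
        unfolding sum_distrib_left using \<mu>(2) by (intro sum_mono mult_right_mono) auto
      also have "\<dots> \<le> (norm (x - metric_proj C x))\<^sup>2 - (norm (averaged_proj \<omega> U m x - metric_proj C x))\<^sup>2"
        using w by (intro averaged_proj_displacement assms(2,3) PC) (auto intro: less_imp_le)
      finally show "(\<Sum>i=1..m. (norm (x - metric_proj (U i) x))\<^sup>2) \<le> 1 / \<mu> *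
          ((norm (x - metric_proj (\<Inter>i\<in>{1..m}. U i) x))\<^sup>2
            - (norm (averaged_proj \<omega> U m x - metric_proj (\<Inter>i\<in>{1..m}. U i) x))\<^sup>2)"
        unfolding C_def[symmetric] using \<mu>(1) by (simp add: field_simps)
    qed simp_all
  }
  note averaged = this
  fix \<omega> :: "nat \<Rightarrow> real"
  assume "closed (\<Sum>i=1..m. (par (U i))\<^sup>\<bottom>)"
    and "(\<forall>i\<in>{1..m}. 0 < \<omega> i \<and> \<omega> i \<le> 1) \<and> (\<Sum>i=1..m. \<omega> i) = 1"
  note av = averaged[OF this]
  show "BAM (averaged_proj \<omega> U m)"
    using av by blast
  show "\<exists>\<gamma>::real. 0 \<le> \<gamma> \<and> \<gamma> < 1 \<and> (\<forall>x. \<forall>k::nat.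
      norm ((averaged_proj \<omega> U m ^^ k) x - metric_proj (\<Inter>i\<in>{1..m}. U i) x)
        \<le> \<gamma> ^ k * norm (x - metric_proj (\<Inter>i\<in>{1..m}. U i) x))"
    using av by blast
qed

end
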